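(* Let $\mathcal{A}$, $\mathcal{X}$, $\mathcal{Y}$ be abelian categories and suppose there is a recollement of $\mathcal{A}$ by $\mathcal{Y}$ and $\mathcal{X}$. Then $\mathcal{A}$ is well-powered if and only if $\mathcal{X}$ and $\mathcal{Y}$ are well-powered.
   Context: Standing assumption: in every abelian category considered, $\mathrm{Ext}^1(X,Y)$ (Yoneda extensions) is a set for all objects $X,Y$. A recollement of an abelian category $\mathcal{A}$ by abelian categories $\mathcal{Y}$ and $\mathcal{X}$ consists of additive functors $i_*:\mathcal{Y}\to\mathcal{A}$, $i^*,i^!:\mathcal{A}\to\mathcal{Y}$, $j^*:\mathcal{A}\to\mathcal{X}$, $j_!,j_*:\mathcal{X}\to\mathcal{A}$ such that (i) $i^*\dashv i_*\dashv i^!$ and $j_!\dashv j^*\dashv j_*$; (ii) $i_*,j_!,j_*$ are fully faithful; (iii) $\mathrm{Im}(i_* )=\mathrm{Ker}(j^* )$ (essential image). An abelian category is well-powered if for each object $M$ the isomorphism classes of subobjects of $M$ form a set. *)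

theory Defs
  imports "HOL-Algebra.Group"
begin

unbundle cardinal_syntax

section \<open>Size\<close>

text \<open>
  The distinction between sets and proper classes is made relative to a universe, given by an
  infinite regular strong limit cardinal \<open>\<kappa>\<close>: a collection, of any HOL type, ``is a set'' iff its
  cardinality is below \<open>\<kappa>\<close>.  The uncountable such \<open>\<kappa>\<close> are the inaccessible cardinals, that is, the
  Grothendieck universes containing the natural numbers.  Uncountability is not required since HOL
  does not prove that an inaccessible cardinal exists; the countable one is the universe of
  hereditarily finite sets.
\<close>

definition universe_card :: "'k rel \<Rightarrow> bool" where
  "universe_card \<kappa> \<longleftrightarrow> Card_order \<kappa> \<and> infinite (Field \<kappa>) \<and> regularCard \<kappa> \<and>
     (\<forall>S \<subseteq> Field \<kappa>. |S| <o \<kappa> \<longrightarrow> |Pow S| <o \<kappa>)"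

definition is_small :: "'k rel \<Rightarrow> 's set \<Rightarrow> bool" where
  "is_small \<kappa> S \<longleftrightarrow> |S| <o \<kappa>"

lemma universe_card_natLeq: "universe_card natLeq"
proof -
  have "regularCard natLeq"
    using natLeq_Card_order natLeq_cinfinite stable_natLeq stable_regularCard
    unfolding cinfinite_def by blast
  moreover have "|Pow S| <o natLeq" if "|S| <o natLeq" for S :: "nat set"
    using that finite_iff_ordLess_natLeq[of S] finite_iff_ordLess_natLeq[of "Pow S"] by simp
  ultimately show ?thesis
    unfolding universe_card_def
    using natLeq_Card_order natLeq_cinfinite cinfinite_def by blast
qed


section \<open>Abelian categories\<close>

text \<open>
  The zero arrows and the addition of parallel arrows are part of the data; both are only
  meaningful on the hom-sets, where preadditivity makes them abelian group structures.
\<close>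

record ('o, 'm) cat =
  Obj :: "'o set"
  Arr :: "'m set"
  Dom :: "'m \<Rightarrow> 'o"
  Cod :: "'m \<Rightarrow> 'o"
  Ident :: "'o \<Rightarrow> 'm"
  Comp :: "'m \<Rightarrow> 'm \<Rightarrow> 'm"  (infixl "\<cdot>\<index>" 70)
  Zero :: "'o \<Rightarrow> 'o \<Rightarrow> 'm"
  Plus :: "'m \<Rightarrow> 'm \<Rightarrow> 'm"  (infixl "\<boxplus>\<index>" 65)

definition Hom :: "('o, 'm) cat \<Rightarrow> 'o \<Rightarrow> 'o \<Rightarrow> 'm set" where
  "Hom C a b = {f \<in> Arr C. Dom C f = a \<and> Cod C f = b}"

definition hom_group :: "('o, 'm) cat \<Rightarrow> 'o \<Rightarrow> 'o \<Rightarrow> 'm monoid" where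
  "hom_group C a b = \<lparr>carrier = Hom C a b, monoid.mult = Plus C, one = Zero C a b\<rparr>"

locale category =
  fixes C :: "('o, 'm) cat" (structure)
  assumes dom_obj: "f \<in> Arr C \<Longrightarrow> Dom C f \<in> Obj C"
    and cod_obj: "f \<in> Arr C \<Longrightarrow> Cod C f \<in> Obj C"
    and ident_hom: "a \<in> Obj C \<Longrightarrow> Ident C a \<in> Hom C a a"
    and comp_hom: "\<lbrakk>f \<in> Hom C a b; g \<in> Hom C b c\<rbrakk> \<Longrightarrow> g \<cdot> f \<in> Hom C a c"
    and comp_ident: "f \<in> Hom C a b \<Longrightarrow> f \<cdot> Ident C a = f"
    and ident_comp: "f \<in> Hom C a b \<Longrightarrow> Ident C b \<cdot> f = f"
    and comp_assoc: "\<lbrakk>f \<in> Hom C a b; g \<in> Hom C b c; h \<in> Hom C c d\<rbrakk> \<Longrightarrow>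
      h \<cdot> (g \<cdot> f) = (h \<cdot> g) \<cdot> f"

definition is_mono :: "('o, 'm) cat \<Rightarrow> 'm \<Rightarrow> bool" where
  "is_mono C f \<longleftrightarrow> f \<in> Arr C \<and>
     (\<forall>a \<in> Obj C. \<forall>g \<in> Hom C a (Dom C f). \<forall>h \<in> Hom C a (Dom C f).
        f \<cdot>\<^bsub>C\<^esub> g = f \<cdot>\<^bsub>C\<^esub> h \<longrightarrow> g = h)"

definition is_epi :: "('o, 'm) cat \<Rightarrow> 'm \<Rightarrow> bool" where
  "is_epi C f \<longleftrightarrow> f \<in> Arr C \<and>
     (\<forall>a \<in> Obj C. \<forall>g \<in> Hom C (Cod C f) a. \<forall>h \<in> Hom C (Cod C f) a.
        g \<cdot>\<^bsub>C\<^esub> f = h \<cdot>\<^bsub>C\<^esub> f \<longrightarrow> g = h)"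

definition is_iso :: "('o, 'm) cat \<Rightarrow> 'm \<Rightarrow> bool" where
  "is_iso C f \<longleftrightarrow> f \<in> Arr C \<and>
     (\<exists>g \<in> Hom C (Cod C f) (Dom C f).
        g \<cdot>\<^bsub>C\<^esub> f = Ident C (Dom C f) \<and> f \<cdot>\<^bsub>C\<^esub> g = Ident C (Cod C f))"

definition isomorphic :: "('o, 'm) cat \<Rightarrow> 'o \<Rightarrow> 'o \<Rightarrow> bool" where
  "isomorphic C a b \<longleftrightarrow> (\<exists>f \<in> Hom C a b. is_iso C f)"

definition is_zero_obj :: "('o, 'm) cat \<Rightarrow> 'o \<Rightarrow> bool" where
  "is_zero_obj C z \<longleftrightarrow> z \<in> Obj C \<and>
     (\<forall>a \<in> Obj C. (\<exists>!f. f \<in> Hom C a z) \<and> (\<exists>!f. f \<in> Hom C z a))"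

definition is_biproduct ::
    "('o, 'm) cat \<Rightarrow> 'o \<Rightarrow> 'o \<Rightarrow> 'o \<Rightarrow> 'm \<Rightarrow> 'm \<Rightarrow> 'm \<Rightarrow> 'm \<Rightarrow> bool" where
  "is_biproduct C a b p i1 i2 p1 p2 \<longleftrightarrow>
     i1 \<in> Hom C a p \<and> i2 \<in> Hom C b p \<and> p1 \<in> Hom C p a \<and> p2 \<in> Hom C p b \<and>
     p1 \<cdot>\<^bsub>C\<^esub> i1 = Ident C a \<and> p2 \<cdot>\<^bsub>C\<^esub> i2 = Ident C b \<and>
     p1 \<cdot>\<^bsub>C\<^esub> i2 = Zero C b a \<and> p2 \<cdot>\<^bsub>C\<^esub> i1 = Zero C a b \<and>
     (i1 \<cdot>\<^bsub>C\<^esub> p1) \<boxplus>\<^bsub>C\<^esub> (i2 \<cdot>\<^bsub>C\<^esub> p2) = Ident C p"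

definition is_kernel :: "('o, 'm) cat \<Rightarrow> 'm \<Rightarrow> 'm \<Rightarrow> bool" where
  "is_kernel C k f \<longleftrightarrow> f \<in> Arr C \<and> k \<in> Arr C \<and> Cod C k = Dom C f \<and>
     f \<cdot>\<^bsub>C\<^esub> k = Zero C (Dom C k) (Cod C f) \<and>
     (\<forall>a \<in> Obj C. \<forall>h \<in> Hom C a (Dom C f). f \<cdot>\<^bsub>C\<^esub> h = Zero C a (Cod C f) \<longrightarrow>
        (\<exists>!u. u \<in> Hom C a (Dom C k) \<and> k \<cdot>\<^bsub>C\<^esub> u = h))"

definition is_cokernel :: "('o, 'm) cat \<Rightarrow> 'm \<Rightarrow> 'm \<Rightarrow> bool" where
  "is_cokernel C q f \<longleftrightarrow> f \<in> Arr C \<and> q \<in> Arr C \<and> Dom C q = Cod C f \<and>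
     q \<cdot>\<^bsub>C\<^esub> f = Zero C (Dom C f) (Cod C q) \<and>
     (\<forall>a \<in> Obj C. \<forall>h \<in> Hom C (Cod C f) a. h \<cdot>\<^bsub>C\<^esub> f = Zero C (Dom C f) a \<longrightarrow>
        (\<exists>!u. u \<in> Hom C (Cod C q) a \<and> u \<cdot>\<^bsub>C\<^esub> q = h))"

locale preadditive_category = category +
  assumes hom_comm_group: "\<lbrakk>a \<in> Obj C; b \<in> Obj C\<rbrakk> \<Longrightarrow> comm_group (hom_group C a b)"
    and comp_plus: "\<lbrakk>f \<in> Hom C a b; f' \<in> Hom C a b; g \<in> Hom C b c\<rbrakk> \<Longrightarrow>
      g \<cdot> (f \<boxplus> f') = (g \<cdot> f) \<boxplus> (g \<cdot> f')"
    and plus_comp: "\<lbrakk>f \<in> Hom C a b; g \<in> Hom C b c; g' \<in> Hom C b c\<rbrakk> \<Longrightarrow>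
      (g \<boxplus> g') \<cdot> f = (g \<cdot> f) \<boxplus> (g' \<cdot> f)"

locale abelian_category = preadditive_category +
  assumes zero_obj_exists: "\<exists>z. is_zero_obj C z"
    and biproduct_exists: "\<lbrakk>a \<in> Obj C; b \<in> Obj C\<rbrakk> \<Longrightarrow>
      \<exists>p \<in> Obj C. \<exists>i1 i2 p1 p2. is_biproduct C a b p i1 i2 p1 p2"
    and kernel_exists: "f \<in> Arr C \<Longrightarrow> \<exists>k. is_kernel C k f"
    and cokernel_exists: "f \<in> Arr C \<Longrightarrow> \<exists>q. is_cokernel C q f"
    and mono_is_kernel: "is_mono C f \<Longrightarrow> \<exists>g. is_kernel C f g"
    and epi_is_cokernel: "is_epi C f \<Longrightarrow> \<exists>g. is_cokernel C f g"


section \<open>Size conditions on a category\<close>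

definition locally_small :: "'k rel \<Rightarrow> ('o, 'm) cat \<Rightarrow> bool" where
  "locally_small \<kappa> C \<longleftrightarrow> (\<forall>a \<in> Obj C. \<forall>b \<in> Obj C. is_small \<kappa> (Hom C a b))"

text \<open>
  A pair \<open>(i, p)\<close> in \<open>extensions C x y\<close> is a short exact sequence \<open>0 \<rightarrow> y \<rightarrow> e \<rightarrow> x \<rightarrow> 0\<close>.  The arrow
  \<open>u\<close> in \<open>ext_rel\<close> is automatically an isomorphism in an abelian category (five lemma), so
  \<open>ext_rel\<close> is an equivalence relation there.
\<close>

definition extensions :: "('o, 'm) cat \<Rightarrow> 'o \<Rightarrow> 'o \<Rightarrow> ('m \<times> 'm) set" where
  "extensions C x y = {(i, p). Dom C i = y \<and> Cod C p = x \<and> is_kernel C i p \<and> is_cokernel C p i}"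

definition ext_rel :: "('o, 'm) cat \<Rightarrow> 'o \<Rightarrow> 'o \<Rightarrow> ('m \<times> 'm) rel" where
  "ext_rel C x y = {((i, p), (i', p')).
     (i, p) \<in> extensions C x y \<and> (i', p') \<in> extensions C x y \<and>
     (\<exists>u \<in> Hom C (Cod C i) (Cod C i'). u \<cdot>\<^bsub>C\<^esub> i = i' \<and> p' \<cdot>\<^bsub>C\<^esub> u = p)}"

definition Ext1 :: "('o, 'm) cat \<Rightarrow> 'o \<Rightarrow> 'o \<Rightarrow> ('m \<times> 'm) set set" where
  "Ext1 C x y = extensions C x y // ext_rel C x y"

definition ext_small :: "'k rel \<Rightarrow> ('o, 'm) cat \<Rightarrow> bool" where
  "ext_small \<kappa> C \<longleftrightarrow> (\<forall>x \<in> Obj C. \<forall>y \<in> Obj C. is_small \<kappa> (Ext1 C x y))"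

definition monos_into :: "('o, 'm) cat \<Rightarrow> 'o \<Rightarrow> 'm set" where
  "monos_into C a = {m. is_mono C m \<and> Cod C m = a}"

definition subobj_rel :: "('o, 'm) cat \<Rightarrow> 'o \<Rightarrow> 'm rel" where
  "subobj_rel C a = {(m, n). m \<in> monos_into C a \<and> n \<in> monos_into C a \<and>
     (\<exists>h \<in> Hom C (Dom C m) (Dom C n). is_iso C h \<and> n \<cdot>\<^bsub>C\<^esub> h = m)}"

definition well_powered :: "'k rel \<Rightarrow> ('o, 'm) cat \<Rightarrow> bool" where
  "well_powered \<kappa> C \<longleftrightarrow> (\<forall>a \<in> Obj C. is_small \<kappa> (monos_into C a // subobj_rel C a))"


section \<open>Functors, adjunctions and recollements\<close>

record ('o, 'm, 'p, 'n) func =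
  ob :: "'o \<Rightarrow> 'p"
  ar :: "'m \<Rightarrow> 'n"

definition is_functor :: "('o, 'm) cat \<Rightarrow> ('p, 'n) cat \<Rightarrow> ('o, 'm, 'p, 'n) func \<Rightarrow> bool" where
  "is_functor C D F \<longleftrightarrow>
     (\<forall>a \<in> Obj C. ob F a \<in> Obj D) \<and>
     (\<forall>a \<in> Obj C. \<forall>b \<in> Obj C. \<forall>f \<in> Hom C a b. ar F f \<in> Hom D (ob F a) (ob F b)) \<and>
     (\<forall>a \<in> Obj C. ar F (Ident C a) = Ident D (ob F a)) \<and>
     (\<forall>a \<in> Obj C. \<forall>b \<in> Obj C. \<forall>c \<in> Obj C. \<forall>f \<in> Hom C a b. \<forall>g \<in> Hom C b c.
        ar F (g \<cdot>\<^bsub>C\<^esub> f) = ar F g \<cdot>\<^bsub>D\<^esub> ar F f)"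

definition is_additive_functor ::
    "('o, 'm) cat \<Rightarrow> ('p, 'n) cat \<Rightarrow> ('o, 'm, 'p, 'n) func \<Rightarrow> bool" where
  "is_additive_functor C D F \<longleftrightarrow> is_functor C D F \<and>
     (\<forall>a \<in> Obj C. \<forall>b \<in> Obj C. ar F \<in> hom (hom_group C a b) (hom_group D (ob F a) (ob F b)))"

definition fully_faithful :: "('o, 'm) cat \<Rightarrow> ('p, 'n) cat \<Rightarrow> ('o, 'm, 'p, 'n) func \<Rightarrow> bool" where
  "fully_faithful C D F \<longleftrightarrow>
     (\<forall>a \<in> Obj C. \<forall>b \<in> Obj C. bij_betw (ar F) (Hom C a b) (Hom D (ob F a) (ob F b)))"

text \<open>
  \<open>adjoint C D F G\<close>: the functor \<open>F\<close> from \<open>C\<close> to \<open>D\<close> is left adjoint to \<open>G\<close>.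
\<close>

definition adjoint ::
    "('o, 'm) cat \<Rightarrow> ('p, 'n) cat \<Rightarrow> ('o, 'm, 'p, 'n) func \<Rightarrow> ('p, 'n, 'o, 'm) func \<Rightarrow> bool" where
  "adjoint C D F G \<longleftrightarrow>
     (\<exists>\<phi>. (\<forall>a \<in> Obj C. \<forall>b \<in> Obj D. bij_betw (\<phi> a b) (Hom D (ob F a) b) (Hom C a (ob G b))) \<and>
          (\<forall>a \<in> Obj C. \<forall>a' \<in> Obj C. \<forall>b \<in> Obj D. \<forall>b' \<in> Obj D.
             \<forall>f \<in> Hom C a' a. \<forall>g \<in> Hom D b b'. \<forall>h \<in> Hom D (ob F a) b.
               \<phi> a' b' (g \<cdot>\<^bsub>D\<^esub> h \<cdot>\<^bsub>D\<^esub> ar F f) = ar G g \<cdot>\<^bsub>C\<^esub> \<phi> a b h \<cdot>\<^bsub>C\<^esub> f))"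

definition ess_image :: "('o, 'm) cat \<Rightarrow> ('p, 'n) cat \<Rightarrow> ('o, 'm, 'p, 'n) func \<Rightarrow> 'p set" where
  "ess_image C D F = {b \<in> Obj D. \<exists>a \<in> Obj C. isomorphic D (ob F a) b}"

definition functor_kernel :: "('o, 'm) cat \<Rightarrow> ('p, 'n) cat \<Rightarrow> ('o, 'm, 'p, 'n) func \<Rightarrow> 'o set" where
  "functor_kernel C D F = {a \<in> Obj C. is_zero_obj D (ob F a)}"

text \<open>
  Recollement of \<open>A\<close> by \<open>Y\<close> and \<open>X\<close>.  In the usual notation the functors \<open>il\<close>, \<open>i\<close>, \<open>ir\<close> are
  \<open>i\<^sup>*\<close>, \<open>i\<^sub>*\<close>, \<open>i\<^sup>!\<close>, and \<open>jl\<close>, \<open>j\<close>, \<open>jr\<close> are \<open>j\<^sub>!\<close>, \<open>j\<^sup>*\<close>, \<open>j\<^sub>*\<close>.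
\<close>

locale recollement =
  Y: abelian_category Y + A: abelian_category A + X: abelian_category X
  for Y :: "('oy, 'my) cat" and A :: "('oa, 'ma) cat" and X :: "('ox, 'mx) cat" +
  fixes il :: "('oa, 'ma, 'oy, 'my) func"
    and i :: "('oy, 'my, 'oa, 'ma) func"
    and ir :: "('oa, 'ma, 'oy, 'my) func"
    and jl :: "('ox, 'mx, 'oa, 'ma) func"
    and j :: "('oa, 'ma, 'ox, 'mx) func"
    and jr :: "('ox, 'mx, 'oa, 'ma) func"
  assumes additive: "is_additive_functor A Y il" "is_additive_functor Y A i"
      "is_additive_functor A Y ir" "is_additive_functor X A jl"
      "is_additive_functor A X j" "is_additive_functor X A jr"
    and adjoint_i: "adjoint A Y il i" "adjoint Y A i ir"
    and adjoint_j: "adjoint X A jl j" "adjoint A X j jr"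
    and ff: "fully_faithful Y A i" "fully_faithful X A jl" "fully_faithful X A jr"
    and image_eq_kernel: "ess_image Y A i = functor_kernel A X j"

end

theory Submission
  imports Defs
begin

text \<open>
  Full faithfulness transports well-poweredness from \<open>A\<close> to \<open>Y\<close> and \<open>X\<close>.  The functors \<open>i\<close> and \<open>jr\<close>
  are right adjoints, hence preserve monomorphisms, and they are fully faithful, hence two
  subobjects with isomorphic images are already isomorphic (\<open>well_powered_reflected\<close>).

  Conversely, a subobject \<open>m : N \<rightarrow> M\<close> in \<open>A\<close> is determined up to isomorphism by two pieces of data,
  each ranging over a set.  The first is the class of the subobject \<open>j m\<close> of \<open>j M\<close>.  Choose a
  representative \<open>s\<close> of it and let \<open>q : M \<rightarrow> Q\<close> be the cokernel of the transpose \<open>jl S \<rightarrow> M\<close> of \<open>s\<close>,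
  which is independent of \<open>m\<close>; the kernel of \<open>q\<close> is the image of \<open>jl (j N)\<close> in \<open>M\<close> and so is contained
  in \<open>N\<close>.  Since \<open>j\<close> kills the composite \<open>q m\<close> and is exact, it also kills the image of \<open>q m\<close>, which
  therefore comes from an object \<open>Z\<close> of \<open>Y\<close> (\<open>factors_through_Y\<close>).  The second piece of data is the
  class of the subobject of \<open>ir Q\<close> that is the transpose of the inclusion \<open>i Z \<rightarrow> Q\<close>.  It determines
  the image of \<open>N\<close> in \<open>Q\<close>, and \<open>N\<close> is the inverse image under \<open>q\<close> of that image
  (\<open>lift_through_subobject\<close>).  Regularity of the universe bounds the number of pairs.
\<close>


section \<open>Small collections\<close>

lemma is_small_Sigma:
  assumes "universe_card \<kappa>" "is_small \<kappa> S" "\<And>s. s \<in> S \<Longrightarrow> is_small \<kappa> (T s)"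
  shows "is_small \<kappa> (Sigma S T)"
  using assms regularCard_stable[of \<kappa>] stable_elim[of \<kappa> S T]
  unfolding universe_card_def is_small_def by blast

text \<open>
  The invariant is a relation rather than a function, so that an invariant depending on auxiliary
  choices need not be made single-valued.
\<close>

lemma is_small_quotient_by_invariant:
  assumes R: "equiv M R" and S: "is_small \<kappa> S"
    and total: "\<And>m. m \<in> M \<Longrightarrow> \<exists>t \<in> S. P m t"
    and complete: "\<And>m n t. \<lbrakk>m \<in> M; n \<in> M; t \<in> S; P m t; P n t\<rbrakk> \<Longrightarrow> (m, n) \<in> R"
  shows "is_small \<kappa> (M // R)"
proof -
  have "\<forall>c \<in> M // R. \<exists>t. t \<in> S \<and> (\<exists>m \<in> M. c = R `` {m} \<and> P m t)"
    using total unfolding quotient_def by blast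
  then obtain T where T: "\<forall>c \<in> M // R. T c \<in> S \<and> (\<exists>m \<in> M. c = R `` {m} \<and> P m (T c))"
    by metis
  have "inj_on T (M // R)"
  proof (rule inj_onI)
    fix c d assume c: "c \<in> M // R" and d: "d \<in> M // R" and eq: "T c = T d"
    obtain m where m: "m \<in> M" "c = R `` {m}" "P m (T c)" using T c by blast
    obtain n where n: "n \<in> M" "d = R `` {n}" "P n (T d)" using T d by blast
    have "(m, n) \<in> R" using complete m n eq T c by metis
    then show "c = d" using m n R by (simp add: equiv_class_eq)
  qed
  moreover have "T ` (M // R) \<subseteq> S" using T by blast
  ultimately have "|M // R| \<le>o |S|" using card_of_ordLeq by blast
  then show ?thesis using S ordLeq_ordLess_trans unfolding is_small_def by blast
qed


section \<open>Monomorphisms and subobjects\<close>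

lemma monoD:
  assumes "is_mono C m" "m \<in> Hom C a b"
    and "c \<in> Obj C" "f \<in> Hom C c a" "g \<in> Hom C c a" "m \<cdot>\<^bsub>C\<^esub> f = m \<cdot>\<^bsub>C\<^esub> g"
  shows "f = g"
  using assms unfolding is_mono_def Hom_def by blast

lemma epiD:
  assumes "is_epi C e" "e \<in> Hom C a b"
    and "c \<in> Obj C" "f \<in> Hom C b c" "g \<in> Hom C b c" "f \<cdot>\<^bsub>C\<^esub> e = g \<cdot>\<^bsub>C\<^esub> e"
  shows "f = g"
  using assms unfolding is_epi_def Hom_def by blast

lemma monoI:
  assumes "m \<in> Hom C a b"
    and "\<And>c f g. \<lbrakk>c \<in> Obj C; f \<in> Hom C c a; g \<in> Hom C c a; m \<cdot>\<^bsub>C\<^esub> f = m \<cdot>\<^bsub>C\<^esub> g\<rbrakk> \<Longrightarrow> f = g"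
  shows "is_mono C m"
  using assms unfolding is_mono_def Hom_def by blast

lemma epiI:
  assumes "e \<in> Hom C a b"
    and "\<And>c f g. \<lbrakk>c \<in> Obj C; f \<in> Hom C b c; g \<in> Hom C b c; f \<cdot>\<^bsub>C\<^esub> e = g \<cdot>\<^bsub>C\<^esub> e\<rbrakk> \<Longrightarrow> f = g"
  shows "is_epi C e"
  using assms unfolding is_epi_def Hom_def by blast

lemma monos_intoI: "\<lbrakk>is_mono C m; m \<in> Hom C a b\<rbrakk> \<Longrightarrow> m \<in> monos_into C b"
  by (simp add: monos_into_def Hom_def)

lemma monos_intoE:
  assumes "m \<in> monos_into C b"
  obtains a where "is_mono C m" "m \<in> Hom C a b"
  using assms by (auto simp: monos_into_def is_mono_def Hom_def)

lemma isoE: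
  assumes "is_iso C h" "h \<in> Hom C a b"
  obtains k where "k \<in> Hom C b a" "k \<cdot>\<^bsub>C\<^esub> h = Ident C a" "h \<cdot>\<^bsub>C\<^esub> k = Ident C b"
  using assms by (auto simp: is_iso_def Hom_def)

lemma isoI:
  assumes "h \<in> Hom C a b" "k \<in> Hom C b a" "k \<cdot>\<^bsub>C\<^esub> h = Ident C a" "h \<cdot>\<^bsub>C\<^esub> k = Ident C b"
  shows "is_iso C h"
  using assms by (auto simp: is_iso_def Hom_def)

context category
begin

lemma Hom_obj: "f \<in> Hom C a b \<Longrightarrow> a \<in> Obj C" "f \<in> Hom C a b \<Longrightarrow> b \<in> Obj C"
  using dom_obj cod_obj by (auto simp: Hom_def)

lemma mono_comp:
  assumes "is_mono C f" "is_mono C g" "f \<in> Hom C a b" "g \<in> Hom C b c"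
  shows "is_mono C (g \<cdot> f)"
proof (rule monoI)
  show "g \<cdot> f \<in> Hom C a c" using assms comp_hom by blast
  fix d u v assume d: "d \<in> Obj C" "u \<in> Hom C d a" "v \<in> Hom C d a" "g \<cdot> f \<cdot> u = g \<cdot> f \<cdot> v"
  then have "g \<cdot> (f \<cdot> u) = g \<cdot> (f \<cdot> v)"
    using comp_assoc[OF d(2) assms(3,4)] comp_assoc[OF d(3) assms(3,4)] by simp
  then have "f \<cdot> u = f \<cdot> v" using monoD[of C g b c d "f \<cdot> u" "f \<cdot> v"] assms d comp_hom by blast
  then show "u = v" using monoD assms d by metis
qed

lemma epi_comp:
  assumes "is_epi C f" "is_epi C g" "f \<in> Hom C a b" "g \<in> Hom C b c"
  shows "is_epi C (g \<cdot> f)"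
proof (rule epiI)
  show "g \<cdot> f \<in> Hom C a c" using assms comp_hom by blast
  fix d u v assume d: "d \<in> Obj C" "u \<in> Hom C c d" "v \<in> Hom C c d" "u \<cdot> (g \<cdot> f) = v \<cdot> (g \<cdot> f)"
  then have "(u \<cdot> g) \<cdot> f = (v \<cdot> g) \<cdot> f"
    using comp_assoc[OF assms(3,4) d(2)] comp_assoc[OF assms(3,4) d(3)] by simp
  then have "u \<cdot> g = v \<cdot> g"
    using epiD[OF assms(1,3) d(1) comp_hom[OF assms(4) d(2)] comp_hom[OF assms(4) d(3)]] by blast
  then show "u = v" using epiD[OF assms(2,4) d(1-3)] by blast
qed

lemma split_mono:
  assumes "s \<in> Hom C a b" "r \<in> Hom C b a" "r \<cdot> s = Ident C a"
  shows "is_mono C s"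
proof (rule monoI[OF assms(1)])
  fix d f g assume f: "f \<in> Hom C d a" and g: "g \<in> Hom C d a" and eq: "s \<cdot> f = s \<cdot> g"
  have "f = r \<cdot> (s \<cdot> f)" using comp_assoc[OF f assms(1,2)] assms(3) ident_comp[OF f] by simp
  also have "\<dots> = r \<cdot> (s \<cdot> g)" using eq by simp
  also have "\<dots> = g" using comp_assoc[OF g assms(1,2)] assms(3) ident_comp[OF g] by simp
  finally show "f = g" .
qed

lemma split_epi:
  assumes "s \<in> Hom C a b" "r \<in> Hom C b a" "r \<cdot> s = Ident C a"
  shows "is_epi C r"
proof (rule epiI[OF assms(2)])
  fix d f g assume f: "f \<in> Hom C a d" and g: "g \<in> Hom C a d" and eq: "f \<cdot> r = g \<cdot> r"
  have "f = (f \<cdot> r) \<cdot> s" using comp_assoc[OF assms(1,2) f] assms(3) comp_ident[OF f] by simp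
  also have "\<dots> = (g \<cdot> r) \<cdot> s" using eq by simp
  also have "\<dots> = g" using comp_assoc[OF assms(1,2) g] assms(3) comp_ident[OF g] by simp
  finally show "f = g" .
qed

text \<open>
  The mediating arrow is an isomorphism as soon as each of the two monomorphisms factors through
  the other.
\<close>

lemma subobj_relI:
  assumes m: "is_mono C m" "m \<in> Hom C a b" and n: "is_mono C n" "n \<in> Hom C a' b"
    and u: "u \<in> Hom C a a'" "n \<cdot> u = m" and v: "v \<in> Hom C a' a" "m \<cdot> v = n"
  shows "(m, n) \<in> subobj_rel C b"
proof -
  have "m \<cdot> (v \<cdot> u) = m \<cdot> Ident C a" using comp_assoc[OF u(1) v(1) m(2)] comp_ident[OF m(2)] u(2) v(2) by simp
  then have vu: "v \<cdot> u = Ident C a"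
    using monoD[OF m _ comp_hom[OF u(1) v(1)]] ident_hom Hom_obj(1)[OF u(1)] by blast
  have "n \<cdot> (u \<cdot> v) = n \<cdot> Ident C a'" using comp_assoc[OF v(1) u(1) n(2)] comp_ident[OF n(2)] u(2) v(2) by simp
  then have uv: "u \<cdot> v = Ident C a'"
    using monoD[OF n _ comp_hom[OF v(1) u(1)]] ident_hom Hom_obj(1)[OF v(1)] by blast
  have "is_iso C u" using isoI[OF u(1) v(1) vu uv] .
  then show ?thesis
    using assms monos_intoI[OF m] monos_intoI[OF n] by (auto simp: subobj_rel_def Hom_def)
qed

lemma subobj_relE:
  assumes "(m, n) \<in> subobj_rel C b" "m \<in> Hom C a b" "n \<in> Hom C a' b"
  obtains u v where "u \<in> Hom C a a'" "n \<cdot> u = m" "v \<in> Hom C a' a" "m \<cdot> v = n"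
    "v \<cdot> u = Ident C a" "u \<cdot> v = Ident C a'"
proof -
  obtain u where u: "u \<in> Hom C a a'" "is_iso C u" "n \<cdot> u = m"
    using assms by (auto simp: subobj_rel_def Hom_def)
  obtain v where v: "v \<in> Hom C a' a" "v \<cdot> u = Ident C a" "u \<cdot> v = Ident C a'"
    using isoE[OF u(2,1)] by blast
  have "m \<cdot> v = n"
    using comp_assoc[OF v(1) u(1) assms(3)] u(3) v(3) comp_ident[OF assms(3)] by simp
  then show thesis using that u v by blast
qed

lemma equiv_subobj_rel: "equiv (monos_into C b) (subobj_rel C b)"
proof (rule equivI)
  show "subobj_rel C b \<subseteq> monos_into C b \<times> monos_into C b" by (auto simp: subobj_rel_def)
  show "refl_on (monos_into C b) (subobj_rel C b)"
  proof (rule refl_onI)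
    fix m assume "m \<in> monos_into C b"
    then obtain a where m: "is_mono C m" "m \<in> Hom C a b" by (rule monos_intoE)
    then show "(m, m) \<in> subobj_rel C b"
      using subobj_relI[OF m m] ident_hom comp_ident Hom_obj by blast
  qed
  show "sym (subobj_rel C b)"
  proof (rule symI)
    fix m n assume mn: "(m, n) \<in> subobj_rel C b"
    then have "m \<in> monos_into C b" "n \<in> monos_into C b" by (auto simp: subobj_rel_def)
    then obtain a a' where m: "is_mono C m" "m \<in> Hom C a b" and n: "is_mono C n" "n \<in> Hom C a' b"
      by (metis monos_intoE)
    obtain u v where "u \<in> Hom C a a'" "n \<cdot> u = m" "v \<in> Hom C a' a" "m \<cdot> v = n"
      using subobj_relE[OF mn m(2) n(2)] by blast
    then show "(n, m) \<in> subobj_rel C b" using subobj_relI m n by blast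
  qed
  show "trans (subobj_rel C b)"
  proof (rule transI)
    fix m n k assume mn: "(m, n) \<in> subobj_rel C b" and nk: "(n, k) \<in> subobj_rel C b"
    then have "m \<in> monos_into C b" "n \<in> monos_into C b" "k \<in> monos_into C b"
      by (auto simp: subobj_rel_def)
    then obtain a a' a'' where m: "is_mono C m" "m \<in> Hom C a b" and n: "is_mono C n" "n \<in> Hom C a' b"
      and k: "is_mono C k" "k \<in> Hom C a'' b"
      by (metis monos_intoE)
    obtain u v where u: "u \<in> Hom C a a'" "n \<cdot> u = m" "v \<in> Hom C a' a" "m \<cdot> v = n"
      using subobj_relE[OF mn m(2) n(2)] by blast
    obtain u' v' where u': "u' \<in> Hom C a' a''" "k \<cdot> u' = n" "v' \<in> Hom C a'' a'" "n \<cdot> v' = k"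
      using subobj_relE[OF nk n(2) k(2)] by blast
    have "k \<cdot> (u' \<cdot> u) = m" using comp_assoc[OF u(1) u'(1) k(2)] u u' by simp
    moreover have "m \<cdot> (v \<cdot> v') = k" using comp_assoc[OF u'(3) u(3) m(2)] u u' by simp
    ultimately show "(m, k) \<in> subobj_rel C b"
      using subobj_relI[OF m k] u u' comp_hom by blast
  qed
qed

lemma subobj_class_eq:
  assumes "m \<in> c" "n \<in> c" "c \<in> monos_into C b // subobj_rel C b"
  shows "(m, n) \<in> subobj_rel C b"
  using quotient_eq_iff[OF equiv_subobj_rel] assms by blast

end


section \<open>Factorisations in an abelian category\<close>

context preadditive_category
begin

lemma zero_hom: "\<lbrakk>a \<in> Obj C; b \<in> Obj C\<rbrakk> \<Longrightarrow> Zero C a b \<in> Hom C a b"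
  using comm_group.axioms(1)[OF hom_comm_group] comm_monoid.axioms(1) monoid.one_closed
  unfolding hom_group_def by fastforce

lemma comp_zero:
  assumes "g \<in> Hom C b c" "a \<in> Obj C"
  shows "g \<cdot> Zero C a b = Zero C a c"
proof -
  have o: "b \<in> Obj C" "c \<in> Obj C" using assms Hom_obj by auto
  interpret s: group "hom_group C a b" using comm_group.axioms(2)[OF hom_comm_group] assms o by blast
  interpret t: group "hom_group C a c" using comm_group.axioms(2)[OF hom_comm_group] assms o by blast
  have z: "Zero C a b \<in> Hom C a b" using zero_hom assms o by blast
  have "Zero C a b \<boxplus> Zero C a b = Zero C a b"
    using s.l_one[OF s.one_closed] by (simp add: hom_group_def)
  then have "(g \<cdot> Zero C a b) \<boxplus> (g \<cdot> Zero C a b) = g \<cdot> Zero C a b"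
    using comp_plus[OF z z assms(1)] by simp
  then show ?thesis
    using t.l_cancel_one[of "g \<cdot> Zero C a b" "g \<cdot> Zero C a b"] comp_hom[OF z assms(1)]
    by (simp add: hom_group_def)
qed

lemma zero_comp:
  assumes "f \<in> Hom C a b" "c \<in> Obj C"
  shows "Zero C b c \<cdot> f = Zero C a c"
proof -
  have o: "a \<in> Obj C" "b \<in> Obj C" using assms Hom_obj by auto
  interpret s: group "hom_group C b c" using comm_group.axioms(2)[OF hom_comm_group] assms o by blast
  interpret t: group "hom_group C a c" using comm_group.axioms(2)[OF hom_comm_group] assms o by blast
  have z: "Zero C b c \<in> Hom C b c" using zero_hom assms o by blast
  have "Zero C b c \<boxplus> Zero C b c = Zero C b c"
    using s.l_one[OF s.one_closed] by (simp add: hom_group_def)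
  then have "(Zero C b c \<cdot> f) \<boxplus> (Zero C b c \<cdot> f) = Zero C b c \<cdot> f"
    using plus_comp[OF assms(1) z z] by simp
  then show ?thesis
    using t.l_cancel_one[of "Zero C b c \<cdot> f" "Zero C b c \<cdot> f"] comp_hom[OF assms(1) z]
    by (simp add: hom_group_def)
qed

lemma epi_by_zero_test:
  assumes e: "e \<in> Hom C a b"
    and test: "\<And>c g. \<lbrakk>g \<in> Hom C b c; g \<cdot> e = Zero C a c\<rbrakk> \<Longrightarrow> g = Zero C b c"
  shows "is_epi C e"
proof (rule epiI[OF e])
  fix c f g assume c: "c \<in> Obj C" and f: "f \<in> Hom C b c" and g: "g \<in> Hom C b c"
    and eq: "f \<cdot> e = g \<cdot> e"
  have o: "a \<in> Obj C" "b \<in> Obj C" using e Hom_obj by auto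
  interpret G: group "hom_group C b c" using comm_group.axioms(2)[OF hom_comm_group] c o by blast
  define n where "n = inv\<^bsub>hom_group C b c\<^esub> g"
  have n: "n \<in> Hom C b c"
    using G.inv_closed g unfolding n_def by (simp add: hom_group_def)
  have gn: "g \<boxplus> n = Zero C b c"
    using G.r_inv g unfolding n_def by (simp add: hom_group_def)
  have p: "f \<boxplus> n \<in> Hom C b c" using G.m_closed f n by (simp add: hom_group_def)
  have "(f \<boxplus> n) \<cdot> e = (g \<boxplus> n) \<cdot> e" using plus_comp[OF e] f g n eq by metis
  also have "\<dots> = Zero C a c" using gn zero_comp[OF e c] by simp
  finally have "f \<boxplus> n = g \<boxplus> n" using test[OF p] gn by simp
  then show "f = g" using G.right_cancel[of n f g] f g n by (simp add: hom_group_def)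
qed

lemma kernelE:
  assumes "is_kernel C k f" "f \<in> Hom C b c"
  obtains a where "k \<in> Hom C a b" "is_mono C k" "f \<cdot> k = Zero C a c"
    "\<And>d h. \<lbrakk>h \<in> Hom C d b; f \<cdot> h = Zero C d c\<rbrakk> \<Longrightarrow> \<exists>u \<in> Hom C d a. k \<cdot> u = h"
proof -
  have f: "Dom C f = b" "Cod C f = c" using assms by (auto simp: Hom_def)
  define a where "a = Dom C k"
  have k: "k \<in> Hom C a b" "f \<cdot> k = Zero C a c"
    using assms f by (auto simp: is_kernel_def a_def Hom_def)
  have lift: "\<exists>!u. u \<in> Hom C d a \<and> k \<cdot> u = h" if "h \<in> Hom C d b" "f \<cdot> h = Zero C d c" for d h
    using assms(1) that f Hom_obj(1)[OF that(1)] by (simp add: is_kernel_def a_def)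
  have "is_mono C k"
  proof (rule monoI[OF k(1)])
    fix d u v assume d: "d \<in> Obj C" and u: "u \<in> Hom C d a" and v: "v \<in> Hom C d a"
      and eq: "k \<cdot> u = k \<cdot> v"
    have "f \<cdot> (k \<cdot> u) = Zero C d c"
      using comp_assoc[OF u k(1) assms(2)] k(2) zero_comp[OF u] Hom_obj[OF assms(2)] by simp
    then show "u = v" using lift[OF comp_hom[OF u k(1)]] u v eq by metis
  qed
  then show thesis using that k lift by blast
qed

lemma cokernelE:
  assumes "is_cokernel C q f" "f \<in> Hom C a b"
  obtains c where "q \<in> Hom C b c" "q \<cdot> f = Zero C a c"
    "\<And>d h. \<lbrakk>h \<in> Hom C b d; h \<cdot> f = Zero C a d\<rbrakk> \<Longrightarrow> \<exists>u \<in> Hom C c d. u \<cdot> q = h"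
proof -
  have f: "Dom C f = a" "Cod C f = b" using assms by (auto simp: Hom_def)
  have q: "q \<in> Hom C b (Cod C q)" "q \<cdot> f = Zero C a (Cod C q)"
    using assms f by (auto simp: is_cokernel_def Hom_def)
  have "\<exists>u \<in> Hom C (Cod C q) d. u \<cdot> q = h" if "h \<in> Hom C b d" "h \<cdot> f = Zero C a d" for d h
    using assms(1) that f Hom_obj(2)[OF that(1)] unfolding is_cokernel_def by blast
  then show thesis using that q by blast
qed

lemma zero_obj_if_zero_mono:
  assumes k: "is_mono C k" "k \<in> Hom C a b" and zero: "k = Zero C a b"
  shows "is_zero_obj C a"
proof -
  have o: "a \<in> Obj C" "b \<in> Obj C" using k Hom_obj by auto
  have into: "f = g" if "c \<in> Obj C" "f \<in> Hom C c a" "g \<in> Hom C c a" for c f g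
    using monoD[OF k that] zero zero_comp that o by metis
  have id: "Ident C a = Zero C a a" using into ident_hom zero_hom o by blast
  have out: "f = Zero C a c" if "f \<in> Hom C a c" for c f
    using comp_ident[OF that] comp_zero[OF that] id o by simp
  have "\<exists>!f. f \<in> Hom C c a" "\<exists>!f. f \<in> Hom C a c" if "c \<in> Obj C" for c
    using zero_hom into out that o by metis+
  then show ?thesis using o by (simp add: is_zero_obj_def)
qed

end

context abelian_category
begin

text \<open>
  A monomorphism, being the kernel of some \<open>g\<close>, is the kernel of its own cokernel \<open>r\<close>: the arrow
  \<open>g\<close> factors through \<open>r\<close>, so it kills whatever \<open>r\<close> kills.
\<close>

lemma factors_through_mono:
  assumes m: "is_mono C m" "m \<in> Hom C a b" and r: "is_cokernel C r m"
    and h: "h \<in> Hom C d b" and rh: "r \<cdot> h = Zero C d (Cod C r)"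
  shows "\<exists>u \<in> Hom C d a. m \<cdot> u = h"
proof -
  obtain g where g: "is_kernel C m g" using mono_is_kernel[OF m(1)] by blast
  define c where "c = Cod C g"
  have gh: "g \<in> Hom C b c" using g m by (auto simp: is_kernel_def c_def Hom_def)
  obtain a' where ker: "m \<in> Hom C a' b" "g \<cdot> m = Zero C a' c"
    "\<And>d h. \<lbrakk>h \<in> Hom C d b; g \<cdot> h = Zero C d c\<rbrakk> \<Longrightarrow> \<exists>u \<in> Hom C d a'. m \<cdot> u = h"
    using kernelE[OF g gh] by metis
  have [simp]: "a' = a" using ker m by (simp add: Hom_def)
  obtain e where coker: "r \<in> Hom C b e"
    "\<And>d h. \<lbrakk>h \<in> Hom C b d; h \<cdot> m = Zero C a d\<rbrakk> \<Longrightarrow> \<exists>u \<in> Hom C e d. u \<cdot> r = h"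
    using cokernelE[OF r m(2)] by metis
  obtain t where t: "t \<in> Hom C e c" "t \<cdot> r = g" using coker(2)[OF gh] ker(2) by auto
  have "g \<cdot> h = t \<cdot> (r \<cdot> h)" using comp_assoc[OF h coker(1) t(1)] t(2) by simp
  also have "\<dots> = Zero C d c" using rh comp_zero[OF t(1)] Hom_obj[OF h] coker(1) by (simp add: Hom_def)
  finally show ?thesis using ker(3)[OF h] by simp
qed

text \<open>
  The image is the kernel \<open>k\<close> of the cokernel \<open>q\<close>.  The induced arrow \<open>p\<close> is epic: if \<open>g p = 0\<close> and
  \<open>w\<close> is the kernel of \<open>g\<close>, then the arrow factors through the monomorphism \<open>k w\<close>, so the cokernel \<open>v\<close>
  of \<open>k w\<close> factors through \<open>q\<close> and kills \<open>k\<close>; hence \<open>k\<close> factors through \<open>k w\<close>, which makes \<open>w\<close> split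
  epic and \<open>g\<close> zero.
\<close>

lemma image_factorisation:
  assumes f: "f \<in> Hom C a b"
  obtains c k p where "k \<in> Hom C c b" "is_mono C k" "p \<in> Hom C a c" "is_epi C p" "k \<cdot> p = f"
proof -
  obtain q where q: "is_cokernel C q f" using cokernel_exists f by (auto simp: Hom_def)
  obtain e where coker: "q \<in> Hom C b e" "q \<cdot> f = Zero C a e"
    "\<And>d h. \<lbrakk>h \<in> Hom C b d; h \<cdot> f = Zero C a d\<rbrakk> \<Longrightarrow> \<exists>u \<in> Hom C e d. u \<cdot> q = h"
    using cokernelE[OF q f] by metis
  obtain k where k: "is_kernel C k q" using kernel_exists coker(1) by (auto simp: Hom_def)
  obtain c where ker: "k \<in> Hom C c b" "is_mono C k" "q \<cdot> k = Zero C c e"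
    "\<And>d h. \<lbrakk>h \<in> Hom C d b; q \<cdot> h = Zero C d e\<rbrakk> \<Longrightarrow> \<exists>u \<in> Hom C d c. k \<cdot> u = h"
    using kernelE[OF k coker(1)] by metis
  obtain p where p: "p \<in> Hom C a c" "k \<cdot> p = f" using ker(4)[OF f coker(2)] by blast
  have "is_epi C p"
  proof (rule epi_by_zero_test[OF p(1)])
    fix d g assume g: "g \<in> Hom C c d" and gp: "g \<cdot> p = Zero C a d"
    obtain w where w: "is_kernel C w g" using kernel_exists g by (auto simp: Hom_def)
    obtain x where kg: "w \<in> Hom C x c" "is_mono C w" "g \<cdot> w = Zero C x d"
      "\<And>d' h. \<lbrakk>h \<in> Hom C d' c; g \<cdot> h = Zero C d' d\<rbrakk> \<Longrightarrow> \<exists>u \<in> Hom C d' x. w \<cdot> u = h"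
      using kernelE[OF w g] by metis
    obtain p' where p': "p' \<in> Hom C a x" "w \<cdot> p' = p" using kg(4)[OF p(1) gp] by blast
    have kw: "k \<cdot> w \<in> Hom C x b" "is_mono C (k \<cdot> w)"
      using comp_hom[OF kg(1) ker(1)] mono_comp[OF kg(2) ker(2) kg(1) ker(1)] by auto
    obtain v where v: "is_cokernel C v (k \<cdot> w)" using cokernel_exists kw by (auto simp: Hom_def)
    obtain y where ckw: "v \<in> Hom C b y" "v \<cdot> (k \<cdot> w) = Zero C x y"
      using cokernelE[OF v kw(1)] by metis
    have [simp]: "Cod C v = y" using ckw by (simp add: Hom_def)
    have y: "y \<in> Obj C" using Hom_obj ckw by blast
    have "v \<cdot> f = (v \<cdot> (k \<cdot> w)) \<cdot> p'"
      using comp_assoc[OF p'(1) kg(1) ker(1)] comp_assoc[OF p'(1) kw(1) ckw(1)] p'(2) p(2) by simp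
    also have "\<dots> = Zero C a y" using ckw(2) zero_comp[OF p'(1) y] by simp
    finally obtain v' where v': "v' \<in> Hom C e y" "v' \<cdot> q = v" using coker(3)[OF ckw(1)] by blast
    have "v \<cdot> k = v' \<cdot> (q \<cdot> k)" using comp_assoc[OF ker(1) coker(1) v'(1)] v'(2) by simp
    also have "\<dots> = Zero C c y" using ker(3) comp_zero[OF v'(1)] Hom_obj ker(1) by simp
    finally obtain u where u: "u \<in> Hom C c x" "k \<cdot> w \<cdot> u = k"
      using factors_through_mono[OF kw(2,1) v ker(1)] by auto
    have "k \<cdot> (w \<cdot> u) = k \<cdot> Ident C c" using comp_assoc[OF u(1) kg(1) ker(1)] comp_ident[OF ker(1)] u(2) by simp
    then have "w \<cdot> u = Ident C c"
      using monoD[OF ker(2,1)] comp_hom[OF u(1) kg(1)] ident_hom Hom_obj ker(1) by blast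
    then have "g = (g \<cdot> w) \<cdot> u" using comp_assoc[OF u(1) kg(1) g] comp_ident[OF g] by simp
    also have "\<dots> = Zero C c d" using kg(3) zero_comp[OF u(1)] Hom_obj(2)[OF g] by simp
    finally show "g = Zero C c d" .
  qed
  then show thesis using that ker p by blast
qed

end


section \<open>Functors and adjunctions\<close>

lemma functor_ob: "\<lbrakk>is_functor C D F; a \<in> Obj C\<rbrakk> \<Longrightarrow> ob F a \<in> Obj D"
  by (simp add: is_functor_def)

lemma functor_hom:
  assumes "category C" "is_functor C D F" "f \<in> Hom C a b"
  shows "ar F f \<in> Hom D (ob F a) (ob F b)"
  using assms(2,3) category.Hom_obj[OF assms(1,3)] by (simp add: is_functor_def)

lemma functor_comp:
  assumes "category C" "is_functor C D F" "f \<in> Hom C a b" "g \<in> Hom C b c"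
  shows "ar F (g \<cdot>\<^bsub>C\<^esub> f) = ar F g \<cdot>\<^bsub>D\<^esub> ar F f"
  using assms(2-4) category.Hom_obj[OF assms(1,3)] category.Hom_obj[OF assms(1,4)]
  unfolding is_functor_def by blast

lemma functor_ident: "\<lbrakk>is_functor C D F; a \<in> Obj C\<rbrakk> \<Longrightarrow> ar F (Ident C a) = Ident D (ob F a)"
  by (simp add: is_functor_def)

lemma additive_functor_zero:
  assumes C: "preadditive_category C" and D: "preadditive_category D"
    and F: "is_additive_functor C D F" and o: "a \<in> Obj C" "b \<in> Obj C"
  shows "ar F (Zero C a b) = Zero D (ob F a) (ob F b)"
proof -
  have o': "ob F a \<in> Obj D" "ob F b \<in> Obj D"
    using F functor_ob[of C D F] o by (simp_all add: is_additive_functor_def)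
  have "ar F \<in> hom (hom_group C a b) (hom_group D (ob F a) (ob F b))"
    using F o unfolding is_additive_functor_def by blast
  moreover have "group (hom_group C a b)" "group (hom_group D (ob F a) (ob F b))"
    using comm_group.axioms(2)[OF preadditive_category.hom_comm_group[OF C o]]
      comm_group.axioms(2)[OF preadditive_category.hom_comm_group[OF D o']] by simp_all
  ultimately have "ar F \<one>\<^bsub>hom_group C a b\<^esub> = \<one>\<^bsub>hom_group D (ob F a) (ob F b)\<^esub>"
    using hom_one by blast
  then show ?thesis by (simp add: hom_group_def)
qed

lemma fully_faithful_full:
  assumes "fully_faithful C D F" "a \<in> Obj C" "b \<in> Obj C" "g \<in> Hom D (ob F a) (ob F b)"
  obtains f where "f \<in> Hom C a b" "ar F f = g"
proof -
  have "g \<in> ar F ` Hom C a b" using assms by (simp add: fully_faithful_def bij_betw_def)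
  then show thesis using that by blast
qed

lemma fully_faithful_faithful:
  assumes "fully_faithful C D F" "a \<in> Obj C" "b \<in> Obj C" "f \<in> Hom C a b" "g \<in> Hom C a b"
    "ar F f = ar F g"
  shows "f = g"
proof -
  have "inj_on (ar F) (Hom C a b)" using assms(1-3) by (simp add: fully_faithful_def bij_betw_def)
  then show ?thesis using assms(4-6) by (simp add: inj_on_def)
qed

text \<open>
  Fixing the transposition \<open>\<phi>\<close>, which sends arrows \<open>F a \<rightarrow> b\<close> to arrows \<open>a \<rightarrow> G b\<close>, makes it
  available to the statements about transposes of monomorphisms and cokernels.
\<close>

locale adjunction = C: category C + D: category D
  for C :: "('o, 'm) cat" and D :: "('p, 'n) cat" +
  fixes F :: "('o, 'm, 'p, 'n) func" and G :: "('p, 'n, 'o, 'm) func"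
    and \<phi> :: "'o \<Rightarrow> 'p \<Rightarrow> 'n \<Rightarrow> 'm"
  assumes F: "is_functor C D F" and G: "is_functor D C G"
    and bij: "\<lbrakk>a \<in> Obj C; b \<in> Obj D\<rbrakk> \<Longrightarrow> bij_betw (\<phi> a b) (Hom D (ob F a) b) (Hom C a (ob G b))"
    and natural: "\<lbrakk>a \<in> Obj C; f \<in> Hom C a' a; g \<in> Hom D b b'; h \<in> Hom D (ob F a) b\<rbrakk> \<Longrightarrow>
      \<phi> a' b' (g \<cdot>\<^bsub>D\<^esub> h \<cdot>\<^bsub>D\<^esub> ar F f) = ar G g \<cdot>\<^bsub>C\<^esub> \<phi> a b h \<cdot>\<^bsub>C\<^esub> f"

lemma adjoint_adjunction:
  assumes "category C" "category D" "is_functor C D F" "is_functor D C G" "adjoint C D F G"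
  obtains \<phi> where "adjunction C D F G \<phi>"
proof -
  obtain \<phi> where bij: "\<forall>a \<in> Obj C. \<forall>b \<in> Obj D.
      bij_betw (\<phi> a b) (Hom D (ob F a) b) (Hom C a (ob G b))"
    and nat: "\<forall>a \<in> Obj C. \<forall>a' \<in> Obj C. \<forall>b \<in> Obj D. \<forall>b' \<in> Obj D.
             \<forall>f \<in> Hom C a' a. \<forall>g \<in> Hom D b b'. \<forall>h \<in> Hom D (ob F a) b.
               \<phi> a' b' (g \<cdot>\<^bsub>D\<^esub> h \<cdot>\<^bsub>D\<^esub> ar F f) = ar G g \<cdot>\<^bsub>C\<^esub> \<phi> a b h \<cdot>\<^bsub>C\<^esub> f"
    using assms(5) unfolding adjoint_def by blast
  have "adjunction C D F G \<phi>"
  proof (intro adjunction.intro adjunction_axioms.intro)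
    fix a b a' b' f g h
    assume "a \<in> Obj C" "f \<in> Hom C a' a" "g \<in> Hom D b b'" "h \<in> Hom D (ob F a) b"
    then show "\<phi> a' b' (g \<cdot>\<^bsub>D\<^esub> h \<cdot>\<^bsub>D\<^esub> ar F f) = ar G g \<cdot>\<^bsub>C\<^esub> \<phi> a b h \<cdot>\<^bsub>C\<^esub> f"
      using nat category.Hom_obj[OF assms(1)] category.Hom_obj[OF assms(2)] by blast
  qed (use assms bij in auto)
  then show thesis using that by blast
qed

context adjunction
begin

lemma transpose_hom:
  assumes "a \<in> Obj C" "h \<in> Hom D (ob F a) b"
  shows "\<phi> a b h \<in> Hom C a (ob G b)"
  using bij_betw_apply[OF bij[OF assms(1) D.Hom_obj(2)[OF assms(2)]] assms(2)] .

lemma transpose_inj: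
  assumes "a \<in> Obj C" "h \<in> Hom D (ob F a) b" "h' \<in> Hom D (ob F a) b" "\<phi> a b h = \<phi> a b h'"
  shows "h = h'"
  using inj_onD[OF bij_betw_imp_inj_on[OF bij[OF assms(1) D.Hom_obj(2)[OF assms(2)]]]]
    assms(2-4) by blast

lemma transpose_surj:
  assumes "b \<in> Obj D" "f \<in> Hom C a (ob G b)"
  obtains h where "h \<in> Hom D (ob F a) b" "\<phi> a b h = f"
proof -
  have "f \<in> \<phi> a b ` Hom D (ob F a) b"
    using bij_betw_imp_surj_on[OF bij[OF C.Hom_obj(1)[OF assms(2)] assms(1)]] assms(2) by simp
  then show thesis using that by blast
qed

lemma transpose_comp_right:
  assumes a: "a \<in> Obj C" and g: "g \<in> Hom D b b'" and h: "h \<in> Hom D (ob F a) b"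
  shows "\<phi> a b' (g \<cdot>\<^bsub>D\<^esub> h) = ar G g \<cdot>\<^bsub>C\<^esub> \<phi> a b h"
proof -
  have "\<phi> a b' (g \<cdot>\<^bsub>D\<^esub> h \<cdot>\<^bsub>D\<^esub> ar F (Ident C a)) = ar G g \<cdot>\<^bsub>C\<^esub> \<phi> a b h \<cdot>\<^bsub>C\<^esub> Ident C a"
    using natural[OF a C.ident_hom[OF a] g h] .
  then show ?thesis
    using functor_ident[OF F a] D.comp_ident[OF D.comp_hom[OF h g]]
      C.comp_ident[OF C.comp_hom[OF transpose_hom[OF a h] functor_hom[OF D.category_axioms G g]]]
    by simp
qed

lemma transpose_comp_left:
  assumes f: "f \<in> Hom C a' a" and h: "h \<in> Hom D (ob F a) b"
  shows "\<phi> a' b (h \<cdot>\<^bsub>D\<^esub> ar F f) = \<phi> a b h \<cdot>\<^bsub>C\<^esub> f"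
proof -
  have a: "a \<in> Obj C" and b: "b \<in> Obj D" using f h C.Hom_obj D.Hom_obj by auto
  have "\<phi> a' b (Ident D b \<cdot>\<^bsub>D\<^esub> h \<cdot>\<^bsub>D\<^esub> ar F f) = ar G (Ident D b) \<cdot>\<^bsub>C\<^esub> \<phi> a b h \<cdot>\<^bsub>C\<^esub> f"
    using natural[OF a f D.ident_hom[OF b] h] .
  then show ?thesis
    using functor_ident[OF G b] D.ident_comp[OF h] C.ident_comp[OF transpose_hom[OF a h]] by simp
qed

lemma right_adjoint_preserves_mono:
  assumes m: "is_mono D m" "m \<in> Hom D b b'"
  shows "is_mono C (ar G m)"
proof (rule monoI)
  show Gm: "ar G m \<in> Hom C (ob G b) (ob G b')" using functor_hom[OF D.category_axioms G m(2)] .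
  have b: "b \<in> Obj D" using D.Hom_obj m by blast
  fix a f g assume a: "a \<in> Obj C" and f: "f \<in> Hom C a (ob G b)" and g: "g \<in> Hom C a (ob G b)"
    and eq: "ar G m \<cdot>\<^bsub>C\<^esub> f = ar G m \<cdot>\<^bsub>C\<^esub> g"
  obtain f' where f': "f' \<in> Hom D (ob F a) b" "\<phi> a b f' = f" using transpose_surj[OF b f] .
  obtain g' where g': "g' \<in> Hom D (ob F a) b" "\<phi> a b g' = g" using transpose_surj[OF b g] .
  have "\<phi> a b' (m \<cdot>\<^bsub>D\<^esub> f') = \<phi> a b' (m \<cdot>\<^bsub>D\<^esub> g')"
    using transpose_comp_right[OF a m(2)] f' g' eq by simp
  then have "m \<cdot>\<^bsub>D\<^esub> f' = m \<cdot>\<^bsub>D\<^esub> g'"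
    using transpose_inj[OF a] D.comp_hom f' g' m(2) by blast
  then have "f' = g'" using monoD[OF m] f' g' functor_ob[OF F a] by blast
  then show "f = g" using f' g' by simp
qed

lemma left_adjoint_preserves_epi:
  assumes e: "is_epi C e" "e \<in> Hom C a a'"
  shows "is_epi D (ar F e)"
proof (rule epiI)
  show Fe: "ar F e \<in> Hom D (ob F a) (ob F a')" using functor_hom[OF C.category_axioms F e(2)] .
  have a': "a' \<in> Obj C" using C.Hom_obj e by blast
  fix b f g assume b: "b \<in> Obj D" and f: "f \<in> Hom D (ob F a') b" and g: "g \<in> Hom D (ob F a') b"
    and "f \<cdot>\<^bsub>D\<^esub> ar F e = g \<cdot>\<^bsub>D\<^esub> ar F e"
  then have "\<phi> a' b f \<cdot>\<^bsub>C\<^esub> e = \<phi> a' b g \<cdot>\<^bsub>C\<^esub> e"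
    using transpose_comp_left[OF e(2)] by metis
  then have "\<phi> a' b f = \<phi> a' b g"
    using epiD[OF e] transpose_hom[OF a'] f g functor_ob[OF G b] by blast
  then show "f = g" using transpose_inj[OF a'] f g by blast
qed

text \<open>
  Precomposing the transpose of \<open>l\<close> with \<open>f\<close> gives the transpose of \<open>l\<close> after \<open>F f\<close>; so equal
  composites can be cancelled in \<open>D\<close>, and faithfulness of \<open>F\<close> brings the result back to \<open>C\<close>.
\<close>

lemma transpose_mono:
  assumes faithful: "fully_faithful C D F" and a: "a \<in> Obj C"
    and l: "is_mono D l" "l \<in> Hom D (ob F a) b"
  shows "is_mono C (\<phi> a b l)"
proof (rule monoI[OF transpose_hom[OF a l(2)]])
  fix c f g assume c: "c \<in> Obj C" and f: "f \<in> Hom C c a" and g: "g \<in> Hom C c a"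
    and eq: "\<phi> a b l \<cdot>\<^bsub>C\<^esub> f = \<phi> a b l \<cdot>\<^bsub>C\<^esub> g"
  have Ff: "ar F f \<in> Hom D (ob F c) (ob F a)" and Fg: "ar F g \<in> Hom D (ob F c) (ob F a)"
    using functor_hom[OF C.category_axioms F] f g by auto
  have "\<phi> c b (l \<cdot>\<^bsub>D\<^esub> ar F f) = \<phi> c b (l \<cdot>\<^bsub>D\<^esub> ar F g)"
    using transpose_comp_left[OF f l(2)] transpose_comp_left[OF g l(2)] eq by simp
  then have "l \<cdot>\<^bsub>D\<^esub> ar F f = l \<cdot>\<^bsub>D\<^esub> ar F g"
    using transpose_inj[OF c] D.comp_hom[OF Ff l(2)] D.comp_hom[OF Fg l(2)] by blast
  then have "ar F f = ar F g" using monoD[OF l functor_ob[OF F c] Ff Fg] by blast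
  then show "f = g" using fully_faithful_faithful[OF faithful c a f g] by blast
qed

lemma transpose_zero:
  assumes "preadditive_category C" "preadditive_category D" "is_additive_functor D C G"
    and a: "a \<in> Obj C" and b: "b \<in> Obj D"
  shows "\<phi> a b (Zero D (ob F a) b) = Zero C a (ob G b)"
proof -
  interpret PC: preadditive_category C by fact
  interpret PD: preadditive_category D by fact
  have z: "Zero D (ob F a) b \<in> Hom D (ob F a) b" "Zero D b b \<in> Hom D b b"
    using PD.zero_hom functor_ob[OF F a] b by auto
  \<comment> \<open>The zero arrow absorbs itself, so the claim is naturality in the target along it.\<close>
  have "\<phi> a b (Zero D (ob F a) b) = \<phi> a b (Zero D b b \<cdot>\<^bsub>D\<^esub> Zero D (ob F a) b)"
    using PD.zero_comp[OF z(1) b] by simp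
  also have "\<dots> = Zero C (ob G b) (ob G b) \<cdot>\<^bsub>C\<^esub> \<phi> a b (Zero D (ob F a) b)"
    using transpose_comp_right[OF a z(2,1)]
      additive_functor_zero[OF assms(2,1,3) b b] by simp
  also have "\<dots> = Zero C a (ob G b)"
    using PC.zero_comp[OF transpose_hom[OF a z(1)]] functor_ob[OF G b] by blast
  finally show ?thesis .
qed

end


section \<open>Well-poweredness along a fully faithful right adjoint\<close>

text \<open>
  The functor \<open>G\<close> induces a map from the subobject classes of \<open>a\<close> to those of \<open>G a\<close>.  It is
  injective, because mutual factorisations of \<open>G m\<close> and \<open>G n\<close> lift through the fully faithful \<open>G\<close>.
\<close>

lemma well_powered_reflected:
  assumes adj: "adjunction D C F G \<phi>" and ff: "fully_faithful C D G" and wp: "well_powered \<kappa> D"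
  shows "well_powered \<kappa> C"
proof -
  interpret adjunction D C F G \<phi> by fact
  note Ghom = functor_hom[OF D.category_axioms G]
  have "is_small \<kappa> (monos_into C a // subobj_rel C a)" if a: "a \<in> Obj C" for a
  proof (rule is_small_quotient_by_invariant
      [where P = "\<lambda>m t. t = subobj_rel D (ob G a) `` {ar G m}"])
    show "equiv (monos_into C a) (subobj_rel C a)" by (rule D.equiv_subobj_rel)
    show "is_small \<kappa> (monos_into D (ob G a) // subobj_rel D (ob G a))"
      using wp functor_ob[OF G a] by (simp add: well_powered_def)
  next
    fix m assume "m \<in> monos_into C a"
    then obtain b where m: "is_mono C m" "m \<in> Hom C b a" by (rule monos_intoE)
    have "ar G m \<in> monos_into D (ob G a)"
      using monos_intoI[OF right_adjoint_preserves_mono[OF m] Ghom[OF m(2)]] .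
    then show "\<exists>t \<in> monos_into D (ob G a) // subobj_rel D (ob G a).
        t = subobj_rel D (ob G a) `` {ar G m}"
      by (simp add: quotientI)
  next
    fix m n t assume "m \<in> monos_into C a" "n \<in> monos_into C a"
      and t: "t = subobj_rel D (ob G a) `` {ar G m}" "t = subobj_rel D (ob G a) `` {ar G n}"
    then obtain b b' where m: "is_mono C m" "m \<in> Hom C b a" and n: "is_mono C n" "n \<in> Hom C b' a"
      by (metis monos_intoE)
    have b: "b \<in> Obj C" "b' \<in> Obj C" using m n D.Hom_obj by auto
    have "ar G n \<in> monos_into D (ob G a)"
      using monos_intoI[OF right_adjoint_preserves_mono[OF n] Ghom[OF n(2)]] .
    then have rel: "(ar G m, ar G n) \<in> subobj_rel D (ob G a)"
      using eq_equiv_class[OF _ C.equiv_subobj_rel] t by metis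
    obtain u v where u: "u \<in> Hom D (ob G b) (ob G b')" "ar G n \<cdot>\<^bsub>D\<^esub> u = ar G m"
      and v: "v \<in> Hom D (ob G b') (ob G b)" "ar G m \<cdot>\<^bsub>D\<^esub> v = ar G n"
      using C.subobj_relE[OF rel Ghom[OF m(2)] Ghom[OF n(2)]] by metis
    obtain u' where u': "u' \<in> Hom C b b'" "ar G u' = u" using fully_faithful_full[OF ff b u(1)] .
    obtain v' where v': "v' \<in> Hom C b' b" "ar G v' = v"
      using fully_faithful_full[OF ff b(2,1) v(1)] .
    have "n \<cdot>\<^bsub>C\<^esub> u' = m"
      using fully_faithful_faithful[OF ff b(1) a D.comp_hom[OF u'(1) n(2)] m(2)]
        functor_comp[OF D.category_axioms G u'(1) n(2)] u u' by simp
    moreover have "m \<cdot>\<^bsub>C\<^esub> v' = n"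
      using fully_faithful_faithful[OF ff b(2) a D.comp_hom[OF v'(1) m(2)] n(2)]
        functor_comp[OF D.category_axioms G v'(1) m(2)] v v' by simp
    ultimately show "(m, n) \<in> subobj_rel C a"
      using D.subobj_relI[OF m n u'(1) _ v'(1)] by blast
  qed
  then show ?thesis by (simp add: well_powered_def)
qed


section \<open>Subobjects in the middle of a recollement\<close>

context recollement
begin

lemma functors:
  "is_functor A Y il" "is_functor Y A i" "is_functor A Y ir"
  "is_functor X A jl" "is_functor A X j" "is_functor X A jr"
  using additive by (simp_all add: is_additive_functor_def)

lemma j_zero: "\<lbrakk>a \<in> Obj A; b \<in> Obj A\<rbrakk> \<Longrightarrow> ar j (Zero A a b) = Zero X (ob j a) (ob j b)"
  using additive_functor_zero[OF A.preadditive_category_axioms X.preadditive_category_axioms]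
    additive by blast

text \<open>
  The functor \<open>j\<close> is both a left and a right adjoint, so it preserves image factorisations: if it
  kills an arrow, it kills the image, which then lies in the kernel of \<open>j\<close>, the essential image of \<open>i\<close>.
\<close>

lemma factors_through_Y:
  assumes f: "f \<in> Hom A a b" and jf: "ar j f = Zero X (ob j a) (ob j b)"
  obtains z l p where "z \<in> Obj Y" "l \<in> Hom A (ob i z) b" "is_mono A l"
    "p \<in> Hom A a (ob i z)" "is_epi A p" "l \<cdot>\<^bsub>A\<^esub> p = f"
proof -
  obtain \<theta> where adj1: "adjunction X A jl j \<theta>"
    using adjoint_adjunction[OF X.category_axioms A.category_axioms functors(4,5) adjoint_j(1)] .
  obtain \<chi> where adj2: "adjunction A X j jr \<chi>"
    using adjoint_adjunction[OF A.category_axioms X.category_axioms functors(5,6) adjoint_j(2)] .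
  note jhom = functor_hom[OF A.category_axioms functors(5)]
  obtain c k p where k: "k \<in> Hom A c b" "is_mono A k" and p: "p \<in> Hom A a c" "is_epi A p"
    and kp: "k \<cdot>\<^bsub>A\<^esub> p = f"
    using A.image_factorisation[OF f] .
  have o: "a \<in> Obj A" "b \<in> Obj A" "c \<in> Obj A" using k p A.Hom_obj by auto
  have jo: "ob j a \<in> Obj X" "ob j b \<in> Obj X" "ob j c \<in> Obj X" using functor_ob[OF functors(5)] o by auto
  have jk: "is_mono X (ar j k)" using adjunction.right_adjoint_preserves_mono[OF adj1 k(2,1)] .
  have jp: "is_epi X (ar j p)" using adjunction.left_adjoint_preserves_epi[OF adj2 p(2,1)] .
  have "ar j k \<cdot>\<^bsub>X\<^esub> ar j p = Zero X (ob j c) (ob j b) \<cdot>\<^bsub>X\<^esub> ar j p"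
    using functor_comp[OF A.category_axioms functors(5) p(1) k(1)] kp jf
      X.zero_comp[OF jhom[OF p(1)] jo(2)] by simp
  then have "ar j k = Zero X (ob j c) (ob j b)"
    using epiD[OF jp jhom[OF p(1)] jo(2) jhom[OF k(1)]] X.zero_hom jo by blast
  then have "is_zero_obj X (ob j c)"
    using X.zero_obj_if_zero_mono[OF jk jhom[OF k(1)]] by blast
  then have "c \<in> ess_image Y A i" using image_eq_kernel o by (simp add: functor_kernel_def)
  then obtain z w where z: "z \<in> Obj Y" and w: "w \<in> Hom A (ob i z) c" "is_iso A w"
    unfolding ess_image_def isomorphic_def by blast
  obtain w' where w': "w' \<in> Hom A c (ob i z)" "w' \<cdot>\<^bsub>A\<^esub> w = Ident A (ob i z)"
    "w \<cdot>\<^bsub>A\<^esub> w' = Ident A c"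
    using isoE[OF w(2,1)] .
  have iz: "ob i z \<in> Obj A" using w A.Hom_obj by blast
  have mono: "is_mono A (k \<cdot>\<^bsub>A\<^esub> w)"
    using A.mono_comp[OF A.split_mono[OF w(1) w'(1,2)] k(2) w(1) k(1)] .
  have w'p: "w' \<cdot>\<^bsub>A\<^esub> p \<in> Hom A a (ob i z)" using A.comp_hom[OF p(1) w'(1)] .
  have "is_epi A (w' \<cdot>\<^bsub>A\<^esub> p)"
    using A.epi_comp[OF p(2) A.split_epi[OF w(1) w'(1,2)] p(1) w'(1)] .
  moreover have "k \<cdot>\<^bsub>A\<^esub> w \<cdot>\<^bsub>A\<^esub> (w' \<cdot>\<^bsub>A\<^esub> p) = f"
    using A.comp_assoc[OF w'p w(1) k(1)] A.comp_assoc[OF p(1) w'(1) w(1)] w'(3)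
      A.ident_comp[OF p(1)] kp by simp
  ultimately show thesis using that[OF z A.comp_hom[OF w(1) k(1)] mono w'p] by blast
qed

text \<open>
  The arrow \<open>q\<close> is the cokernel of the transpose \<open>s'\<close> of a subobject \<open>s\<close> of \<open>j M\<close>.  If \<open>s\<close> lies in the
  subobject \<open>j m'\<close>, then by adjointness \<open>s'\<close> lies in \<open>m'\<close>, so the cokernel \<open>r\<close> of \<open>m'\<close> factors as
  \<open>t q\<close>.  Thus \<open>m'\<close> is the inverse image under \<open>q\<close> of the image of \<open>q m'\<close>, and any \<open>m\<close> for which the
  image of \<open>q m\<close> is contained in that of \<open>q m'\<close> is contained in \<open>m'\<close>.
\<close>

lemma lift_through_subobject:
  assumes adj: "adjunction X A jl j \<theta>"
    and m: "m \<in> Hom A n M" and m': "is_mono A m'" "m' \<in> Hom A n' M"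
    and x: "x \<in> Obj X" and s': "s' \<in> Hom A (ob jl x) M" and q: "is_cokernel A q s'" "q \<in> Hom A M Q"
    and g: "g \<in> Hom X x (ob j n')" "ar j m' \<cdot>\<^bsub>X\<^esub> g = \<theta> x M s'"
    and l: "l \<in> Hom A c Q" and p: "p \<in> Hom A n c" "l \<cdot>\<^bsub>A\<^esub> p = q \<cdot>\<^bsub>A\<^esub> m"
    and l': "l' \<in> Hom A c' Q" and p': "p' \<in> Hom A n' c'" "is_epi A p'" "l' \<cdot>\<^bsub>A\<^esub> p' = q \<cdot>\<^bsub>A\<^esub> m'"
    and h: "h \<in> Hom A c c'" "l' \<cdot>\<^bsub>A\<^esub> h = l"
  shows "\<exists>u \<in> Hom A n n'. m' \<cdot>\<^bsub>A\<^esub> u = m"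
proof -
  interpret adj: adjunction X A jl j \<theta> by fact
  note jhom = functor_hom[OF A.category_axioms functors(5)]
  obtain r where r: "is_cokernel A r m'" using A.cokernel_exists m'(2) by (auto simp: Hom_def)
  obtain R where rR: "r \<in> Hom A M R" "r \<cdot>\<^bsub>A\<^esub> m' = Zero A n' R" using A.cokernelE[OF r m'(2)] by metis
  have R: "R \<in> Obj A" "Cod A r = R" using A.Hom_obj rR by (auto simp: Hom_def)
  have o: "n \<in> Obj A" "n' \<in> Obj A" "c \<in> Obj A" "c' \<in> Obj A"
    using A.Hom_obj m m' l l' by auto
  have "\<theta> x R (r \<cdot>\<^bsub>A\<^esub> s') = (ar j r \<cdot>\<^bsub>X\<^esub> ar j m') \<cdot>\<^bsub>X\<^esub> g"
    using adj.transpose_comp_right[OF x rR(1) s'] g(2)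
      X.comp_assoc[OF g(1) jhom[OF m'(2)] jhom[OF rR(1)]] by simp
  also have "\<dots> = Zero X (ob j n') (ob j R) \<cdot>\<^bsub>X\<^esub> g"
    using functor_comp[OF A.category_axioms functors(5) m'(2) rR(1)] rR(2) j_zero o R by simp
  also have "\<dots> = \<theta> x R (Zero A (ob jl x) R)"
    using X.zero_comp[OF g(1)] functor_ob[OF functors(5) R(1)]
      adj.transpose_zero[OF X.preadditive_category_axioms A.preadditive_category_axioms
        additive(5) x R(1)] by simp
  finally have "r \<cdot>\<^bsub>A\<^esub> s' = Zero A (ob jl x) R"
    using adj.transpose_inj[OF x A.comp_hom[OF s' rR(1)]] A.zero_hom R
      functor_ob[OF functors(4) x] by blast
  moreover obtain Q' where "q \<in> Hom A M Q'"
    "\<And>d h. \<lbrakk>h \<in> Hom A M d; h \<cdot>\<^bsub>A\<^esub> s' = Zero A (ob jl x) d\<rbrakk> \<Longrightarrow> \<exists>u \<in> Hom A Q' d. u \<cdot>\<^bsub>A\<^esub> q = h"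
    using A.cokernelE[OF q(1) s'] by metis
  moreover from this have "Q' = Q" using q(2) by (simp add: Hom_def)
  ultimately obtain t where t: "t \<in> Hom A Q R" "t \<cdot>\<^bsub>A\<^esub> q = r" using rR(1) by blast
  have "(t \<cdot>\<^bsub>A\<^esub> l') \<cdot>\<^bsub>A\<^esub> p' = r \<cdot>\<^bsub>A\<^esub> m'"
    using A.comp_assoc[OF p'(1) l' t(1)] A.comp_assoc[OF m'(2) q(2) t(1)] p'(3) t(2) by simp
  also have "\<dots> = Zero A c' R \<cdot>\<^bsub>A\<^esub> p'" using rR(2) A.zero_comp[OF p'(1) R(1)] by simp
  finally have tl': "t \<cdot>\<^bsub>A\<^esub> l' = Zero A c' R"
    using epiD[OF p'(2,1) R(1) A.comp_hom[OF l' t(1)]] A.zero_hom o R by blast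
  have "r \<cdot>\<^bsub>A\<^esub> m = (t \<cdot>\<^bsub>A\<^esub> l) \<cdot>\<^bsub>A\<^esub> p"
    using A.comp_assoc[OF p(1) l t(1)] A.comp_assoc[OF m q(2) t(1)] p(2) t(2) by simp
  also have "t \<cdot>\<^bsub>A\<^esub> l = Zero A c R"
    using A.comp_assoc[OF h(1) l' t(1)] h(2) tl' A.zero_comp[OF h(1) R(1)] by simp
  also have "Zero A c R \<cdot>\<^bsub>A\<^esub> p = Zero A n R" using A.zero_comp[OF p(1) R(1)] .
  finally show ?thesis using A.factors_through_mono[OF m' r m] R by simp
qed

text \<open>
  The invariant of a subobject \<open>m\<close> is the pair of the class \<open>c\<close> of \<open>j m\<close> and a class \<open>d\<close> of subobjects
  of \<open>ir (Q c)\<close>.  The representative \<open>s c\<close>, its transpose \<open>s' c\<close> and the cokernel \<open>q c\<close> are chosen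
  for each \<open>c\<close> once and for all; hence subobjects with the same \<open>c\<close> have their images compared inside
  one object \<open>Q c\<close>, and for fixed \<open>c\<close> the class \<open>d\<close> ranges over a set.
\<close>

lemma well_powered_middle:
  assumes \<kappa>: "universe_card \<kappa>" and wX: "well_powered \<kappa> X" and wY: "well_powered \<kappa> Y"
  shows "well_powered \<kappa> A"
proof -
  obtain \<theta> where adjj: "adjunction X A jl j \<theta>"
    using adjoint_adjunction[OF X.category_axioms A.category_axioms functors(4,5) adjoint_j(1)] .
  interpret J: adjunction X A jl j \<theta> by fact
  obtain \<psi> where adji: "adjunction Y A i ir \<psi>"
    using adjoint_adjunction[OF Y.category_axioms A.category_axioms functors(2,3) adjoint_i(2)] .
  interpret I: adjunction Y A i ir \<psi> by fact
  note jhom = functor_hom[OF A.category_axioms functors(5)]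
  note ihom = functor_hom[OF Y.category_axioms functors(2)]
  have "is_small \<kappa> (monos_into A M // subobj_rel A M)" if M: "M \<in> Obj A" for M
  proof -
    define SX where "SX = monos_into X (ob j M) // subobj_rel X (ob j M)"
    define SY where "SY b = monos_into Y (ob ir b) // subobj_rel Y (ob ir b)" for b
    have "\<exists>s s' q x. s \<in> c \<and> x \<in> Obj X \<and> s \<in> Hom X x (ob j M) \<and> s' \<in> Hom A (ob jl x) M \<and>
        \<theta> x M s' = s \<and> is_cokernel A q s'" if "c \<in> SX" for c
    proof -
      obtain s where s: "s \<in> c" "s \<in> monos_into X (ob j M)"
        using in_quotient_imp_non_empty[OF X.equiv_subobj_rel, of c]
          in_quotient_imp_subset[OF X.equiv_subobj_rel, of c] \<open>c \<in> SX\<close> unfolding SX_def by blast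
      obtain x where x: "s \<in> Hom X x (ob j M)" using s(2) by (rule monos_intoE)
      obtain s' where s': "s' \<in> Hom A (ob jl x) M" "\<theta> x M s' = s"
        using J.transpose_surj[OF M x] .
      obtain q where "is_cokernel A q s'" using A.cokernel_exists s' by (auto simp: Hom_def)
      then show ?thesis using s x s' X.Hom_obj by blast
    qed
    then obtain s s' q x where choice: "\<And>c. c \<in> SX \<Longrightarrow> s c \<in> c \<and> x c \<in> Obj X \<and>
        s c \<in> Hom X (x c) (ob j M) \<and> s' c \<in> Hom A (ob jl (x c)) M \<and>
        \<theta> (x c) M (s' c) = s c \<and> is_cokernel A (q c) (s' c)"
      by metis
    define Q where "Q c = Cod A (q c)" for c
    have qQ: "q c \<in> Hom A M (Q c)" "q c \<cdot>\<^bsub>A\<^esub> s' c = Zero A (ob jl (x c)) (Q c)" "Q c \<in> Obj A"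
      if "c \<in> SX" for c
      using choice[OF that] A.cod_obj by (auto simp: is_cokernel_def Q_def Hom_def)
    define P where "P m t \<longleftrightarrow> (case t of (c, d) \<Rightarrow> ar j m \<in> c \<and>
        (\<exists>z l p. z \<in> Obj Y \<and> l \<in> Hom A (ob i z) (Q c) \<and> p \<in> Hom A (Dom A m) (ob i z) \<and>
          is_epi A p \<and> l \<cdot>\<^bsub>A\<^esub> p = q c \<cdot>\<^bsub>A\<^esub> m \<and> \<psi> z (Q c) l \<in> d))" for m t
    \<comment> \<open>The invariant is symmetric in the two subobjects, so one inclusion suffices.\<close>
    have lift: "\<exists>u \<in> Hom A n n'. m' \<cdot>\<^bsub>A\<^esub> u = m"
      if m: "m \<in> Hom A n M" and m': "is_mono A m'" "m' \<in> Hom A n' M"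
        and c: "c \<in> SX" and d: "d \<in> SY (Q c)" and P: "P m (c, d)" "P m' (c, d)"
      for m m' n n' c d
    proof -
      have dom: "Dom A m = n" "Dom A m' = n'" using m m' by (auto simp: Hom_def)
      obtain z l p where z: "z \<in> Obj Y" and l: "l \<in> Hom A (ob i z) (Q c)" "\<psi> z (Q c) l \<in> d"
        and p: "p \<in> Hom A n (ob i z)" "l \<cdot>\<^bsub>A\<^esub> p = q c \<cdot>\<^bsub>A\<^esub> m"
        using P(1) dom unfolding P_def by auto
      obtain z' l' p' where z': "z' \<in> Obj Y"
        and l': "l' \<in> Hom A (ob i z') (Q c)" "\<psi> z' (Q c) l' \<in> d"
        and p': "p' \<in> Hom A n' (ob i z')" "is_epi A p'" "l' \<cdot>\<^bsub>A\<^esub> p' = q c \<cdot>\<^bsub>A\<^esub> m'"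
        using P(2) dom unfolding P_def by auto
      have relX: "(s c, ar j m') \<in> subobj_rel X (ob j M)"
        using X.subobj_class_eq choice[OF c] P(2) c unfolding SX_def P_def by blast
      obtain g where g: "g \<in> Hom X (x c) (ob j n')" "ar j m' \<cdot>\<^bsub>X\<^esub> g = s c"
        using X.subobj_relE[OF relX _ jhom[OF m'(2)]] choice[OF c] by metis
      have relY: "(\<psi> z (Q c) l, \<psi> z' (Q c) l') \<in> subobj_rel Y (ob ir (Q c))"
        using Y.subobj_class_eq l(2) l'(2) d unfolding SY_def by blast
      obtain h where h: "h \<in> Hom Y z z'" "\<psi> z' (Q c) l' \<cdot>\<^bsub>Y\<^esub> h = \<psi> z (Q c) l"
        using Y.subobj_relE[OF relY I.transpose_hom[OF z l(1)] I.transpose_hom[OF z' l'(1)]]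
        by metis
      have "\<psi> z (Q c) (l' \<cdot>\<^bsub>A\<^esub> ar i h) = \<psi> z (Q c) l"
        using I.transpose_comp_left[OF h(1) l'(1)] h(2) by simp
      then have "l' \<cdot>\<^bsub>A\<^esub> ar i h = l"
        using I.transpose_inj[OF z A.comp_hom[OF ihom[OF h(1)] l'(1)] l(1)] by blast
      then show ?thesis
        using lift_through_subobject[where s' = "s' c", OF adjj m m' _ _ _ qQ(1)[OF c] g(1) _ l(1) p
            l'(1) p' ihom[OF h(1)]] choice[OF c] g(2) by simp
    qed
    show ?thesis
    proof (rule is_small_quotient_by_invariant[where P = P and S = "SIGMA c : SX. SY (Q c)"])
      show "equiv (monos_into A M) (subobj_rel A M)" by (rule A.equiv_subobj_rel)
      show "is_small \<kappa> (SIGMA c : SX. SY (Q c))"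
      proof (rule is_small_Sigma[OF \<kappa>])
        show "is_small \<kappa> SX"
          using wX functor_ob[OF functors(5) M] by (simp add: well_powered_def SX_def)
        show "is_small \<kappa> (SY (Q c))" if "c \<in> SX" for c
          using wY functor_ob[OF functors(3) qQ(3)[OF that]] by (simp add: well_powered_def SY_def)
      qed
    next
      fix m assume "m \<in> monos_into A M"
      then obtain n where m: "is_mono A m" "m \<in> Hom A n M" by (rule monos_intoE)
      have jm: "ar j m \<in> monos_into X (ob j M)"
        using monos_intoI[OF J.right_adjoint_preserves_mono[OF m] jhom[OF m(2)]] .
      define c where "c = subobj_rel X (ob j M) `` {ar j m}"
      have c: "c \<in> SX" using jm by (simp add: c_def SX_def quotientI)
      have jmc: "ar j m \<in> c"
        using equiv_class_self[OF X.equiv_subobj_rel jm] by (simp add: c_def)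
      note ch = choice[OF c] and qc = qQ[OF c]
      have relX: "(ar j m, s c) \<in> subobj_rel X (ob j M)"
        using X.subobj_class_eq jmc ch c unfolding SX_def by blast
      obtain g where g: "g \<in> Hom X (ob j n) (x c)" "s c \<cdot>\<^bsub>X\<^esub> g = ar j m"
        using X.subobj_relE[OF relX jhom[OF m(2)]] ch by metis
      have sc: "s c \<in> Hom X (x c) (ob j M)" and sc': "s' c \<in> Hom A (ob jl (x c)) M"
        and xc: "x c \<in> Obj X" and tr: "\<theta> (x c) M (s' c) = s c"
        using ch by auto
      have "ar j (q c) \<cdot>\<^bsub>X\<^esub> s c = Zero X (x c) (ob j (Q c))"
        using J.transpose_comp_right[OF xc qc(1) sc'] tr qc(2)
          J.transpose_zero[OF X.preadditive_category_axioms A.preadditive_category_axioms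
            additive(5) xc qc(3)] by simp
      then have "ar j (q c \<cdot>\<^bsub>A\<^esub> m) = Zero X (ob j n) (ob j (Q c))"
        using functor_comp[OF A.category_axioms functors(5) m(2) qc(1)] g(2)
          X.comp_assoc[OF g(1) sc jhom[OF qc(1)]]
          X.zero_comp[OF g(1) functor_ob[OF functors(5) qc(3)]] by simp
      then obtain z l p where z: "z \<in> Obj Y" and l: "l \<in> Hom A (ob i z) (Q c)" "is_mono A l"
        and p: "p \<in> Hom A n (ob i z)" "is_epi A p" "l \<cdot>\<^bsub>A\<^esub> p = q c \<cdot>\<^bsub>A\<^esub> m"
        using factors_through_Y[OF A.comp_hom[OF m(2) qc(1)]] by metis
      have lm: "\<psi> z (Q c) l \<in> monos_into Y (ob ir (Q c))"
        using monos_intoI[OF I.transpose_mono[OF ff(1) z l(2,1)] I.transpose_hom[OF z l(1)]] .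
      define d where "d = subobj_rel Y (ob ir (Q c)) `` {\<psi> z (Q c) l}"
      have d: "d \<in> SY (Q c)" using lm by (simp add: d_def SY_def quotientI)
      have "\<psi> z (Q c) l \<in> d"
        using equiv_class_self[OF Y.equiv_subobj_rel lm] by (simp add: d_def)
      moreover have "Dom A m = n" using m by (simp add: Hom_def)
      ultimately have "P m (c, d)" using jmc z l p unfolding P_def by auto
      then show "\<exists>t \<in> SIGMA c : SX. SY (Q c). P m t" using c d by blast
    next
      fix m m' t assume "m \<in> monos_into A M" "m' \<in> monos_into A M"
        and t: "t \<in> (SIGMA c : SX. SY (Q c))" and P: "P m t" "P m' t"
      then obtain n n' where m: "is_mono A m" "m \<in> Hom A n M"
        and m': "is_mono A m'" "m' \<in> Hom A n' M"
        by (metis monos_intoE)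
      obtain c d where cd: "t = (c, d)" "c \<in> SX" "d \<in> SY (Q c)" using t by blast
      obtain u where u: "u \<in> Hom A n n'" "m' \<cdot>\<^bsub>A\<^esub> u = m"
        using lift[OF m(2) m' cd(2,3)] P cd(1) by blast
      obtain v where v: "v \<in> Hom A n' n" "m \<cdot>\<^bsub>A\<^esub> v = m'"
        using lift[OF m'(2) m cd(2,3)] P cd(1) by blast
      show "(m, m') \<in> subobj_rel A M" using A.subobj_relI[OF m m' u v] .
    qed
  qed
  then show ?thesis by (simp add: well_powered_def)
qed

end


section \<open>Well-poweredness in a recollement\<close>

theorem proposition3p2:
  fixes \<kappa> :: "'k rel"
    and A :: "('oa, 'ma) cat" and X :: "('ox, 'mx) cat" and Y :: "('oy, 'my) cat"
    and il ir :: "('oa, 'ma, 'oy, 'my) func" and i :: "('oy, 'my, 'oa, 'ma) func"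
    and jl jr :: "('ox, 'mx, 'oa, 'ma) func" and j :: "('oa, 'ma, 'ox, 'mx) func"
  assumes "universe_card \<kappa>"
    and "abelian_category A" and "abelian_category X" and "abelian_category Y"
    and "locally_small \<kappa> A" and "locally_small \<kappa> X" and "locally_small \<kappa> Y"
    and "ext_small \<kappa> A" and "ext_small \<kappa> X" and "ext_small \<kappa> Y"
    and "recollement Y A X il i ir jl j jr"
  shows "well_powered \<kappa> A \<longleftrightarrow> well_powered \<kappa> X \<and> well_powered \<kappa> Y"
proof -
  interpret recollement Y A X il i ir jl j jr by fact
  obtain \<phi> where i: "adjunction A Y il i \<phi>"
    using adjoint_adjunction[OF A.category_axioms Y.category_axioms functors(1,2) adjoint_i(1)] .
  obtain \<chi> where j: "adjunction A X j jr \<chi>"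
    using adjoint_adjunction[OF A.category_axioms X.category_axioms functors(5,6) adjoint_j(2)] .
  show ?thesis
    using well_powered_reflected[OF i ff(1)] well_powered_reflected[OF j ff(3)]
      well_powered_middle[OF assms(1)] by blast
qed

end
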